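(* Let $A \in \mathbb{R}^{m \times n}$, $B \in \mathbb{R}^{m \times p}$, $C \in \mathbb{R}^{q \times n}$, let $D \in \mathbb{R}^{m \times m}$ be nonsingular, let $0 \ne e \in \mathbb{R}^{n}$, and let $\mathcal{S} \subseteq \mathbb{R}^{p \times q}$ be a constraint set. If $$X_* \in \operatorname*{argmin}_{X \in \mathcal{S}} \; \left\lVert A \left(I - \frac{ee^{\mathsf T}}{\lVert e \rVert_2^2} \right) - BXC\left(I - \frac{ee^{\mathsf T}}{\lVert e \rVert_2^2} \right) \right\rVert_{\mathsf F}, \qquad x_* = \frac{1}{e^{\mathsf T} e} D^\dagger (BX_*C - A) e,$$ then $(X_*, x_* )$ is a solution to $$\min_{X \in \mathcal{S},\, x\in \mathbb{R}^m} \lVert A- B X C + D x e^{\mathsf T} \rVert_{\mathsf F}.$$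
   Context: $\lVert\cdot\rVert_{\mathsf F}$ is the Frobenius norm, $D^\dagger$ is the Moore–Penrose pseudoinverse, and vectors are column vectors. *)

theory Defs
  imports "HOL-Analysis.Analysis"
begin

definition frobenius_norm :: "real ^ 'n ^ 'm \<Rightarrow> real" where
  "frobenius_norm A = sqrt (\<Sum>i\<in>UNIV. \<Sum>j\<in>UNIV. (A $ i $ j)\<^sup>2)"

lemma frobenius_norm_eq_norm: "frobenius_norm A = norm A"
  by (simp add: frobenius_norm_def norm_vec_def L2_set_def sum_nonneg)

text \<open>The four Penrose conditions; over the reals the conjugate transpose is the transpose.\<close>

definition is_pseudoinverse :: "real ^ 'n ^ 'm \<Rightarrow> real ^ 'm ^ 'n \<Rightarrow> bool" where
  "is_pseudoinverse D P \<longleftrightarrow>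
     D ** P ** D = D \<and> P ** D ** P = P \<and>
     transpose (D ** P) = D ** P \<and> transpose (P ** D) = P ** D"

lemma is_pseudoinverse_unique:
  fixes D :: "real ^ 'n ^ 'm"
  assumes "is_pseudoinverse D P" "is_pseudoinverse D Q"
  shows "P = Q"
proof -
  have p: "D ** P ** D = D" "P ** D ** P = P"
      "transpose (D ** P) = D ** P" "transpose (P ** D) = P ** D"
    and q: "D ** Q ** D = D" "Q ** D ** Q = Q"
      "transpose (D ** Q) = D ** Q" "transpose (Q ** D) = Q ** D"
    using assms by (auto simp: is_pseudoinverse_def)
  have "D ** P = transpose (D ** Q ** (D ** P))"
    by (metis p(3) q(1) matrix_mul_assoc)
  also have "\<dots> = D ** P ** (D ** Q)"
    by (simp add: matrix_transpose_mul[of "D ** Q"] p(3) q(3))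
  also have "\<dots> = D ** Q"
    by (metis p(1) matrix_mul_assoc)
  finally have 1: "D ** P = D ** Q" .
  have "P ** D = transpose (P ** D ** (Q ** D))"
    by (metis matrix_transpose_mul p(4) q(1) q(4) matrix_mul_assoc p(1))
  also have "\<dots> = Q ** D ** (P ** D)"
    by (simp add: matrix_transpose_mul[of "P ** D"] p(4) q(4))
  also have "\<dots> = Q ** D"
    by (metis p(1) matrix_mul_assoc)
  finally have 2: "P ** D = Q ** D" .
  show ?thesis
    by (metis 1 2 p(2) q(2) matrix_mul_assoc)
qed

definition pseudoinverse :: "real ^ 'n ^ 'm \<Rightarrow> real ^ 'm ^ 'n" where
  "pseudoinverse D = (THE P. is_pseudoinverse D P)"

text \<open>The product \<open>u v\<^sup>T\<close>; the type constraints fix the inner dimension to be \<open>1\<close>.\<close>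

definition outer :: "real ^ 'm \<Rightarrow> real ^ 'n \<Rightarrow> real ^ 'n ^ 'm" where
  "outer u v = (columnvector u :: real ^ 1 ^ 'm) ** (rowvector v :: real ^ 'n ^ 1)"

end

theory Submission
  imports Defs
begin

text \<open>
  Write \<open>M = A - B X C\<close> and let \<open>P = I - e e\<^sup>T / \<parallel>e\<parallel>\<^sup>2\<close> be the orthogonal projection along \<open>e\<close>.
  Every row of \<open>M P\<close> is orthogonal to \<open>e\<close>, while every row of a matrix \<open>u e\<^sup>T\<close> is a multiple
  of \<open>e\<close>; so in
  \<open>M + y e\<^sup>T = M P + (y + M e / \<parallel>e\<parallel>\<^sup>2) e\<^sup>T\<close>
  the two summands are orthogonal for the Frobenius inner product. Therefore \<open>\<parallel>M P\<parallel>\<close> is a lower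
  bound for \<open>\<parallel>M + y e\<^sup>T\<parallel>\<close> whatever \<open>y\<close> is (lemma \<open>norm_mult_complement_le\<close>), and it is
  attained at \<open>y = - M e / \<parallel>e\<parallel>\<^sup>2\<close> (lemma \<open>add_optimal_outer\<close>). Since \<open>D\<close> is invertible,
  \<open>D D\<^sup>\<dagger> = I\<close> (lemma \<open>invertible_mult_pseudoinverse\<close>), so \<open>D x\<^sub>0\<close> is exactly this optimal \<open>y\<close>
  for \<open>X = X\<^sub>0\<close>. The joint problem thus reduces to minimising \<open>\<parallel>M P\<parallel>\<close> over \<open>X\<close>, which \<open>X\<^sub>0\<close>
  does by hypothesis.
\<close>

lemma outer_nth: "outer u v $ i $ j = u $ i * v $ j"
  by (simp add: outer_def matrix_matrix_mult_def columnvector_def rowvector_def)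

lemma outer_mult_vector: "outer u v *v w = (v \<bullet> w) *\<^sub>R u"
  by (simp add: vec_eq_iff outer_nth matrix_vector_mult_def inner_vec_def sum_distrib_left
      mult_ac)

lemma inner_outer: "M \<bullet> outer u v = u \<bullet> (M *v v)"
  by (simp add: inner_vec_def outer_nth matrix_vector_mult_def sum_distrib_left mult_ac)

lemma matrix_mult_outer: "M ** outer u v = outer (M *v u) v"
  by (simp add: vec_eq_iff outer_nth matrix_matrix_mult_def matrix_vector_mult_def
      sum_distrib_left mult_ac)

lemma outer_add_left: "outer (u + w) v = outer u v + outer w v"
  by (simp add: vec_eq_iff outer_nth algebra_simps)

lemma outer_scaleR_left: "outer (c *\<^sub>R u) v = c *\<^sub>R outer u v"
  by (simp add: vec_eq_iff outer_nth)

lemma mult_complement: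
  fixes M :: "real ^ 'n ^ 'm"
  shows "M ** (mat 1 - c *\<^sub>R outer e e) = M - c *\<^sub>R outer (M *v e) e"
proof -
  have "M ** (mat 1 - c *\<^sub>R outer e e) = M ** mat 1 - c *\<^sub>R (M ** outer e e)"
    by (simp add: vec_eq_iff matrix_matrix_mult_def sum_subtractf sum_distrib_left algebra_simps)
  then show ?thesis
    by (simp add: matrix_mult_outer)
qed

text \<open>
  The matrix on the left annihilates \<open>e\<close>, so by \<open>inner_outer\<close> it is orthogonal to every matrix
  \<open>u e\<^sup>T\<close>. The matrix on the right differs from it by such a matrix, and Pythagoras applies.
\<close>

lemma norm_mult_complement_le:
  fixes M :: "real ^ 'n ^ 'm" and e :: "real ^ 'n"
  assumes "e \<noteq> 0"
  shows "norm (M ** (mat 1 - (1 / (norm e)\<^sup>2) *\<^sub>R outer e e)) \<le> norm (M + outer y e)"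
proof -
  define c where "c = 1 / (norm e)\<^sup>2"
  define N where "N = M - c *\<^sub>R outer (M *v e) e"
  define R where "R = outer (y + c *\<^sub>R (M *v e)) e"
  have "N *v e = M *v e - (c * (e \<bullet> e)) *\<^sub>R (M *v e)"
    by (simp add: N_def matrix_vector_mult_diff_rdistrib scaleR_matrix_vector_assoc[symmetric]
        outer_mult_vector)
  also have "c * (e \<bullet> e) = 1"
    using assms by (simp add: c_def power2_norm_eq_inner)
  finally have "orthogonal N R"
    by (simp add: orthogonal_def R_def inner_outer)
  then have "(norm (N + R))\<^sup>2 = (norm N)\<^sup>2 + (norm R)\<^sup>2"
    by (rule norm_add_Pythagorean)
  then have "(norm N)\<^sup>2 \<le> (norm (N + R))\<^sup>2"
    by simp
  then have "norm N \<le> norm (N + R)"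
    by (rule power2_le_imp_le) (rule norm_ge_zero)
  moreover have "N + R = M + outer y e"
    by (simp add: N_def R_def outer_add_left outer_scaleR_left)
  ultimately show ?thesis
    by (simp only: mult_complement N_def c_def)
qed

lemma add_optimal_outer:
  fixes M :: "real ^ 'n ^ 'm"
  shows "M + outer (- ((1 / (norm e)\<^sup>2) *\<^sub>R (M *v e))) e
    = M ** (mat 1 - (1 / (norm e)\<^sup>2) *\<^sub>R outer e e)"
  by (simp add: mult_complement vec_eq_iff outer_nth)

lemma invertible_mult_pseudoinverse:
  fixes D :: "real ^ 'm ^ 'm"
  assumes "invertible D"
  shows "D ** pseudoinverse D = mat 1"
proof -
  from assms obtain E where E: "D ** E = mat 1" "E ** D = mat 1"
    by (auto simp: invertible_def)
  then have "is_pseudoinverse D E"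
    by (simp add: is_pseudoinverse_def)
  then have "pseudoinverse D = E"
    unfolding pseudoinverse_def by (blast intro: is_pseudoinverse_unique)
  with E show ?thesis
    by simp
qed

theorem proposition3p2:
  fixes A :: "real ^ 'n ^ 'm"
    and B :: "real ^ 'p ^ 'm"
    and C :: "real ^ 'n ^ 'q"
    and D :: "real ^ 'm ^ 'm"
    and e :: "real ^ 'n"
    and S :: "(real ^ 'q ^ 'p) set"
    and X\<^sub>0 :: "real ^ 'q ^ 'p"
    and x\<^sub>0 :: "real ^ 'm"
  assumes "invertible D"
    and "e \<noteq> 0"
    and "is_arg_min
           (\<lambda>X. frobenius_norm
             (A ** (mat 1 - (1 / (norm e)\<^sup>2) *\<^sub>R outer e e)
              - B ** X ** C ** (mat 1 - (1 / (norm e)\<^sup>2) *\<^sub>R outer e e)))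
           (\<lambda>X. X \<in> S) X\<^sub>0"
    and "x\<^sub>0 = (1 / (e \<bullet> e)) *\<^sub>R (pseudoinverse D *v ((B ** X\<^sub>0 ** C - A) *v e))"
  shows "is_arg_min
           (\<lambda>(X, x). frobenius_norm (A - B ** X ** C + outer (D *v x) e))
           (\<lambda>(X, x). X \<in> S) (X\<^sub>0, x\<^sub>0)"
proof -
  define P where "P = mat 1 - (1 / (norm e)\<^sup>2) *\<^sub>R outer e e"
  define M where "M X = A - B ** X ** C" for X
  have MP: "A ** P - B ** X ** C ** P = M X ** P" for X
    by (simp add: M_def vec_eq_iff matrix_matrix_mult_def[of _ P] sum_subtractf algebra_simps)
  have min: "norm (M X\<^sub>0 ** P) \<le> norm (M X ** P)" if "X \<in> S" for X
    using assms(3) that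
    by (auto simp: is_arg_min_linorder frobenius_norm_eq_norm MP simp flip: P_def)
  have X0: "X\<^sub>0 \<in> S"
    using assms(3) by (simp add: is_arg_min_def)
  have "D *v x\<^sub>0 = (1 / (e \<bullet> e)) *\<^sub>R ((B ** X\<^sub>0 ** C - A) *v e)"
    using assms(1)
    by (simp add: assms(4) matrix_vector_mult_scaleR matrix_vector_mul_assoc matrix_mul_assoc
        invertible_mult_pseudoinverse)
  also have "\<dots> = - ((1 / (norm e)\<^sup>2) *\<^sub>R (M X\<^sub>0 *v e))"
    by (simp add: M_def power2_norm_eq_inner matrix_vector_mult_diff_rdistrib algebra_simps)
  finally have attained: "M X\<^sub>0 + outer (D *v x\<^sub>0) e = M X\<^sub>0 ** P"
    by (simp only: add_optimal_outer P_def)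
  have "norm (M X\<^sub>0 + outer (D *v x\<^sub>0) e) \<le> norm (M X + outer (D *v x) e)" if "X \<in> S" for X x
    using min[OF that] norm_mult_complement_le[OF assms(2), of "M X" "D *v x"]
    by (simp add: attained flip: P_def)
  with X0 show ?thesis
    by (auto simp: is_arg_min_linorder frobenius_norm_eq_norm simp flip: M_def)
qed

end
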